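(* For every positive integer $n$, \[ \det THK(3,n)=\begin{cases}(u_{n-1})^2 & \text{if } n\text{ is odd},\\ 5(u_{n-1})^2 & \text{if } n \text{ is even},\end{cases} \] and in all cases $\det THK(3,n)\neq 0$.
   Context: "Knot" means a knot or link in 3-space. $THK(3,n)$ is the closure of the 3-strand braid $(\sigma_2\sigma_1^{-1})^n\in B_3$. The determinant $\det K$ of a knot $K$ is the (absolute value of the) first minor of the coefficient matrix of the coloring system of a diagram of $K$: one variable per arc and, for each crossing, the equation $2y-x-z=0$, where $y$ is the variable of the over-arc and $x,z$ are those of the two under-arcs. It is a knot invariant. The integers $u_n$ ($n\ge 0$) are given by \[ u_n=\frac{1}{\sqrt5}\left[\left(\frac{1+\sqrt5}{2}\right)^{n+2}-\left(\frac{-1+\sqrt5}{2}\right)^{n}-\left(\frac{1-\sqrt5}{2}\right)^{n+2}+\left(\frac{-1-\sqrt5}{2}\right)^{n}\right]. \] *)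

theory Defs
  imports "Jordan_Normal_Form.Determinant"
begin

text \<open>
  A link diagram is recorded through finitely many marked points on its curves.  A pair in
  \<open>joins\<close> consists of two points connected by a piece of curve that does not pass under a crossing.
  A crossing is a triple \<open>(y, x, z)\<close>: \<open>y\<close> lies on its over-arc, and \<open>x\<close>, \<open>z\<close> lie on the
  under-arcs ending there.  The arcs are the classes of points connected by joins.
\<close>

record 'p link_diagram =
  points :: "'p set"
  joins :: "('p \<times> 'p) set"
  crossings :: "('p \<times> 'p \<times> 'p) list"

definition arc_rel :: "'p link_diagram \<Rightarrow> ('p \<times> 'p) set" where
  "arc_rel D = (joins D \<union> (joins D)\<inverse>)\<^sup>* \<inter> points D \<times> points D"

definition arcs :: "'p link_diagram \<Rightarrow> 'p set set" where
  "arcs D = points D // arc_rel D"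

text \<open>
  The three arcs at a crossing need not be distinct (for instance at a kink), in which case
  their contributions to the equation \<open>2 y - x - z = 0\<close> add up.
\<close>

definition coloring_coeff :: "'p link_diagram \<Rightarrow> 'p \<times> 'p \<times> 'p \<Rightarrow> 'p set \<Rightarrow> int" where
  "coloring_coeff D c A =
     (case c of (y, x, z) \<Rightarrow> 2 * of_bool (y \<in> A) - of_bool (x \<in> A) - of_bool (z \<in> A))"

definition coloring_matrix :: "'p link_diagram \<Rightarrow> 'p set list \<Rightarrow> int mat" where
  "coloring_matrix D as =
     mat (length (crossings D)) (length as) (\<lambda>(r, c). coloring_coeff D (crossings D ! r) (as ! c))"

definition first_minors :: "'p link_diagram \<Rightarrow> int set" where
  "first_minors D =
     {\<bar>det (mat_delete (coloring_matrix D as) r c)\<bar> | as r c.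
        distinct as \<and> set as = arcs D \<and> r < length (crossings D) \<and> c < length as}"

text \<open>
  The determinant is the common absolute value of all first minors, whatever the numbering of
  the arcs and whichever row and column are deleted.  It is meant for diagrams with at least
  one crossing.  If there are more arcs than crossings, then \<open>det\<close> is applied to a non-square
  matrix and yields 0; this is the correct value, since then some component has no undercrossing
  and so is split from the rest.
\<close>

definition link_det :: "'p link_diagram \<Rightarrow> int" where
  "link_det D = the_elem (first_minors D)"

text \<open>The generator $\sigma_i$ and its inverse; strand positions are numbered from 1.\<close>

datatype braid_gen = Gen nat | GenInv nat

fun gen_index :: "braid_gen \<Rightarrow> nat" where
  "gen_index (Gen i) = i"
| "gen_index (GenInv i) = i"

text \<open>
  In $\sigma_i$ the strand from position \<open>i\<close> to \<open>i + 1\<close> passes over the strand from \<open>i + 1\<close>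
  to \<open>i\<close>, and in the inverse it passes under; the opposite convention gives the mirror image.
\<close>

fun over_in :: "braid_gen \<Rightarrow> nat" where
  "over_in (Gen i) = i"
| "over_in (GenInv i) = i + 1"

fun under_in :: "braid_gen \<Rightarrow> nat" where
  "under_in (Gen i) = i + 1"
| "under_in (GenInv i) = i"

text \<open>
  The closure of a braid word on \<open>m\<close> strands.  The point \<open>(t, p)\<close> is at position \<open>p\<close>, after
  the first \<open>t\<close> letters.  At a crossing the two strands swap positions, so the over-strand leaves at
  the position where the under-strand enters, and vice versa.
\<close>

definition closed_braid :: "nat \<Rightarrow> braid_gen list \<Rightarrow> (nat \<times> nat) link_diagram" where
  "closed_braid m w =
     \<lparr>points = {0..length w} \<times> {1..m},
      joins =
        {((t, p), (Suc t, p)) | t p.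
           t < length w \<and> p \<in> {1..m} \<and> p \<noteq> gen_index (w ! t) \<and> p \<noteq> gen_index (w ! t) + 1}
        \<union> {((t, over_in (w ! t)), (Suc t, under_in (w ! t))) | t. t < length w}
        \<union> {((length w, p), (0, p)) | p. p \<in> {1..m}},
      crossings =
        map (\<lambda>t. ((t, over_in (w ! t)), (t, under_in (w ! t)), (Suc t, over_in (w ! t))))
          [0..<length w]\<rparr>"

definition THK3 :: "nat \<Rightarrow> (nat \<times> nat) link_diagram" where
  "THK3 n = closed_braid 3 (concat (replicate n [Gen 2, GenInv 1]))"

definition u :: "nat \<Rightarrow> real" where
  "u n = (1 / sqrt 5) *
     (((1 + sqrt 5) / 2) ^ (n + 2) - ((-1 + sqrt 5) / 2) ^ n
      - ((1 - sqrt 5) / 2) ^ (n + 2) + ((-1 - sqrt 5) / 2) ^ n)"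

end

theory Submission imports Defs
begin

text \<open>
  In the braid word of \<open>THK3 n\<close>, with \<open>N = 2 n\<close> letters, the strand entering each crossing at the
  middle position is the over-strand.  An arc therefore always has the same life: it comes out of
  an undercrossing in the middle, passes over at the next crossing, is not involved in the one
  after that, and goes under at the third.  Numbering each arc by the letter at which it ends
  gives \<open>N\<close> arcs, indexed by the integers modulo \<open>N\<close>, and the equation of crossing \<open>t\<close> becomes
  \<open>2 x\<^bsub>t+2\<^esub> - x\<^bsub>t\<^esub> - x\<^bsub>t+3\<^esub> = 0\<close>.  Up to the order of its columns the coloring matrix is thus the
  circulant of the polynomial \<open>2 X\<^sup>2 - 1 - X\<^sup>3 = - (X - 1) (X\<^sup>2 - X - 1)\<close>.

  Let \<open>S\<close> be the cyclic shift and let \<open>a\<close>, \<open>b\<close> be the roots of \<open>X\<^sup>2 - X - 1\<close>.  The factor \<open>S - 1\<close> is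
  singular and has all first minors equal to \<open>\<plusminus>1\<close>; the other factor \<open>- (S - a) (S - b)\<close> has
  all row and column sums equal to 1, and such a factor simply multiplies every cofactor by its
  determinant (\<open>cofactor_mult_unit_sums\<close>).  Since \<open>det (S - x) = x ^ N - 1\<close> for even \<open>N\<close>
  (\<open>det_shift_minus\<close>), every first minor has absolute value \<open>\<bar>(a ^ N - 1) (b ^ N - 1)\<bar>\<close>.  As
  \<open>a b = -1\<close>, this number is \<open>a ^ (2 n) + b ^ (2 n) - 2\<close>, which is the square of \<open>a ^ n + b ^ n\<close> for odd \<open>n\<close>
  and of \<open>a ^ n - b ^ n\<close> for even \<open>n\<close>.  These are \<open>u (n - 1)\<close> and \<open>sqrt 5 * u (n - 1)\<close>, respectively
  (\<open>u_golden\<close>).  It is nonzero because no \<open>N\<close>-th power of \<open>a\<close> or \<open>b\<close> is 1.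

  Cofactors of a matrix \<open>A\<close> with vanishing row sums are handled throughout by one device: replacing
  row \<open>k\<close> of \<open>A\<close> by \<open>y\<close> gives a matrix whose determinant is the sum of \<open>y\<close> times any
  cofactor of row \<open>k\<close> (\<open>det_replace_row_zero_row_sums\<close>).  Taking \<open>y\<close> constant turns statements on
  minors into statements on full determinants, which are multiplicative and
  behave well under permutations of the columns.
\<close>

section \<open>Cofactors of matrices with vanishing row sums\<close>

definition replace_row :: "'a mat \<Rightarrow> nat \<Rightarrow> (nat \<Rightarrow> 'a) \<Rightarrow> 'a mat" where
  "replace_row A k y = mat (dim_row A) (dim_col A) (\<lambda>(i, j). if i = k then y j else A $$ (i, j))"

text \<open>
  The replaced matrix sends the all-ones vector to a multiple of the \<open>k\<close>-th unit vector, the factor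
  being the sum of \<open>y\<close>.  By Cramer's rule that image may be put in place of column \<open>c\<close>, and
  expansion along this column leaves a single term.
\<close>

lemma det_replace_row_zero_row_sums:
  fixes A :: "'a :: field mat"
  assumes A: "A \<in> carrier_mat n n"
    and rows: "\<And>i. i < n \<Longrightarrow> (\<Sum>j<n. A $$ (i, j)) = 0"
    and k: "k < n" and c: "c < n"
  shows "det (replace_row A k y) = (\<Sum>j<n. y j) * cofactor A k c"
proof -
  define D where "D = replace_row A k y"
  have D: "D \<in> carrier_mat n n" using A by (auto simp: D_def replace_row_def)
  define one where "one = vec n (\<lambda>_. 1 :: 'a)"
  define E where "E = replace_col D (D *\<^sub>v one) c"
  have E: "E \<in> carrier_mat n n" using D by (auto simp: E_def replace_col_def)
  have sums: "(D *\<^sub>v one) $ i = (if i = k then \<Sum>j<n. y j else 0)" if i: "i < n" for i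
    using i A rows[OF i]
    by (auto simp: D_def one_def replace_row_def scalar_prod_def lessThan_atLeast0)
  have "det D = det E"
    using cramer_lemma_mat[OF D _ c, of one] c by (simp add: one_def E_def)
  also have "\<dots> = (\<Sum>i<n. E $$ (i, c) * cofactor E i c)"
    by (rule laplace_expansion_column[OF E c])
  also have "\<dots> = (\<Sum>i<n. if i = k then (\<Sum>j<n. y j) * cofactor E k c else 0)"
  proof (intro sum.cong refl)
    fix i assume i: "i \<in> {..<n}"
    have "E $$ (i, c) = (D *\<^sub>v one) $ i"
      using i D c by (simp add: E_def replace_col_def del: index_mult_mat_vec)
    thus "E $$ (i, c) * cofactor E i c = (if i = k then (\<Sum>j<n. y j) * cofactor E k c else 0)"
      using i by (simp add: sums del: index_mult_mat_vec)
  qed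
  also have "\<dots> = (\<Sum>j<n. y j) * cofactor E k c" using k by simp
  also have "mat_delete E k c = mat_delete A k c"
    using A k c by (intro eq_matI)
      (auto simp: mat_delete_def E_def D_def replace_col_def replace_row_def)
  hence "cofactor E k c = cofactor A k c" by (simp add: cofactor_def)
  finally show ?thesis by (simp add: D_def)
qed

lemma cofactor_transpose:
  assumes A: "A \<in> carrier_mat n n" and "r < n" "c < n"
  shows "cofactor (transpose_mat A) c r = cofactor A r c"
proof -
  have "mat_delete (transpose_mat A) c r = transpose_mat (mat_delete A r c)"
    using assms by (intro eq_matI) (auto simp: mat_delete_def)
  moreover have "mat_delete A r c \<in> carrier_mat (n - 1) (n - 1)"
    by (rule mat_delete_carrier[OF A])
  ultimately show ?thesis by (simp add: cofactor_def det_transpose add.commute)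
qed

text \<open>
  Replacing row \<open>k\<close> by a fixed vector of sum 1 gives a determinant that does not involve \<open>c\<close>.
\<close>

lemma cofactor_eq_in_row:
  fixes A :: "'a :: field mat"
  assumes A: "A \<in> carrier_mat n n"
    and rows: "\<And>i. i < n \<Longrightarrow> (\<Sum>j<n. A $$ (i, j)) = 0"
    and k: "k < n" and c: "c < n" "c' < n"
  shows "cofactor A k c = cofactor A k c'"
  using det_replace_row_zero_row_sums[OF A rows k c(1), of "\<lambda>j. of_bool (j = 0)"]
    det_replace_row_zero_row_sums[OF A rows k c(2), of "\<lambda>j. of_bool (j = 0)"] k
  by (simp add: of_bool_def)

lemma cofactor_eq_zero_row_column_sums:
  fixes A :: "'a :: field mat"
  assumes A: "A \<in> carrier_mat n n"
    and rows: "\<And>i. i < n \<Longrightarrow> (\<Sum>j<n. A $$ (i, j)) = 0"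
    and cols: "\<And>j. j < n \<Longrightarrow> (\<Sum>i<n. A $$ (i, j)) = 0"
    and lt: "r < n" "c < n" "r' < n" "c' < n"
  shows "cofactor A r c = cofactor A r' c'"
proof -
  have "(\<Sum>j<n. transpose_mat A $$ (i, j)) = 0" if "i < n" for i
    using cols[OF that] A that by simp
  hence "cofactor (transpose_mat A) c r = cofactor (transpose_mat A) c r'"
    using A lt by (intro cofactor_eq_in_row[of _ n]) auto
  hence "cofactor A r c = cofactor A r' c" using cofactor_transpose[OF A] lt by simp
  also have "\<dots> = cofactor A r' c'" using A rows lt by (intro cofactor_eq_in_row[of _ n])
  finally show ?thesis .
qed

text \<open>
  Replace row \<open>r\<close> by ones on both sides.  Because the column sums of \<open>Q\<close> are 1, the all-ones row is
  fixed by \<open>Q\<close>, so the replacement commutes with the multiplication by \<open>Q\<close> and the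
  determinant becomes multiplicative.  The row sums of \<open>Q\<close> ensure that \<open>Z * Q\<close> again has vanishing
  row sums.
\<close>

lemma cofactor_mult_unit_sums:
  fixes Z Q :: "'a :: field_char_0 mat"
  assumes Z: "Z \<in> carrier_mat n n" and Q: "Q \<in> carrier_mat n n"
    and rowsZ: "\<And>i. i < n \<Longrightarrow> (\<Sum>j<n. Z $$ (i, j)) = 0"
    and rowsQ: "\<And>i. i < n \<Longrightarrow> (\<Sum>j<n. Q $$ (i, j)) = 1"
    and colsQ: "\<And>j. j < n \<Longrightarrow> (\<Sum>i<n. Q $$ (i, j)) = 1"
    and lt: "r < n" "c < n"
  shows "cofactor (Z * Q) r c = cofactor Z r c * det Q"
proof -
  let ?one = "\<lambda>_ :: nat. 1 :: 'a"
  have ent: "(Z * Q) $$ (i, j) = (\<Sum>l<n. Z $$ (i, l) * Q $$ (l, j))" if "i < n" "j < n" for i j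
    using Z Q that by (simp add: scalar_prod_def lessThan_atLeast0)
  have rows: "(\<Sum>j<n. (Z * Q) $$ (i, j)) = 0" if i: "i < n" for i
  proof -
    have "(\<Sum>j<n. (Z * Q) $$ (i, j)) = (\<Sum>j<n. \<Sum>l<n. Z $$ (i, l) * Q $$ (l, j))"
      using ent i by simp
    also have "\<dots> = (\<Sum>l<n. Z $$ (i, l) * (\<Sum>j<n. Q $$ (l, j)))"
      by (subst sum.swap) (simp add: sum_distrib_left)
    finally show ?thesis using rowsZ[OF i] rowsQ by simp
  qed
  have "replace_row (Z * Q) r ?one = replace_row Z r ?one * Q"
  proof (rule eq_matI)
    fix i j assume "i < dim_row (replace_row Z r ?one * Q)" "j < dim_col (replace_row Z r ?one * Q)"
    hence ij: "i < n" "j < n" using Z Q by (auto simp: replace_row_def)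
    have "(replace_row Z r ?one * Q) $$ (i, j)
        = (\<Sum>l<n. (if i = r then 1 else Z $$ (i, l)) * Q $$ (l, j))"
      using Z Q ij by (simp add: replace_row_def scalar_prod_def lessThan_atLeast0)
    thus "replace_row (Z * Q) r ?one $$ (i, j) = (replace_row Z r ?one * Q) $$ (i, j)"
      using ent[OF ij] colsQ[OF ij(2)] Z Q ij by (simp add: replace_row_def)
  qed (use Z Q in \<open>auto simp: replace_row_def\<close>)
  hence "det (replace_row (Z * Q) r ?one) = det (replace_row Z r ?one) * det Q"
    using Z Q by (subst det_mult[symmetric, of _ n]) (auto simp: replace_row_def)
  hence "of_nat n * cofactor (Z * Q) r c = of_nat n * (cofactor Z r c * det Q)"
    using det_replace_row_zero_row_sums[OF _ rows lt, of ?one]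
      det_replace_row_zero_row_sums[OF Z rowsZ lt, of ?one] Z Q by simp
  thus ?thesis using lt by simp
qed

text \<open>
  An all-ones row is unchanged by a permutation of the columns, so the determinants that express
  the two cofactors differ by the sign of \<open>p\<close>.
\<close>

lemma abs_cofactor_permute_columns:
  fixes A :: "'a :: linordered_field mat"
  assumes A: "A \<in> carrier_mat n n"
    and rows: "\<And>i. i < n \<Longrightarrow> (\<Sum>j<n. A $$ (i, j)) = 0"
    and p: "p permutes {0..<n}"
    and lt: "r < n" "c < n"
  shows "\<bar>cofactor (mat n n (\<lambda>(i, j). A $$ (i, p j))) r c\<bar> = \<bar>cofactor A r c\<bar>"
proof -
  let ?B = "mat n n (\<lambda>(i, j). A $$ (i, p j))"
  let ?one = "\<lambda>_ :: nat. 1 :: 'a"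
  have p_lt: "p j < n" if "j < n" for j using permutes_in_image[OF p, of j] that by simp
  have rowsB: "(\<Sum>j<n. ?B $$ (i, j)) = 0" if i: "i < n" for i
  proof -
    have "(\<Sum>j<n. ?B $$ (i, j)) = (\<Sum>j\<in>{0..<n}. A $$ (i, p j))"
      using i by (simp add: lessThan_atLeast0)
    also have "\<dots> = (\<Sum>j\<in>{0..<n}. A $$ (i, j))"
      using sum.permute[OF p, of "\<lambda>j. A $$ (i, j)"] by (simp add: o_def)
    finally show ?thesis using rows[OF i] by (simp add: lessThan_atLeast0)
  qed
  let ?R = "replace_row A r ?one"
  have R: "?R \<in> carrier_mat n n" using A by (simp add: replace_row_def)
  have "transpose_mat (replace_row ?B r ?one)
      = mat n n (\<lambda>(i, j). transpose_mat ?R $$ (p i, j))"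
    using A p_lt by (intro eq_matI) (auto simp: replace_row_def)
  hence "det (transpose_mat (replace_row ?B r ?one)) = signof p * det (transpose_mat ?R)"
    using R by (simp add: det_permute_rows[OF _ p])
  hence "det (replace_row ?B r ?one) = signof p * det ?R"
    using R by (simp add: det_transpose[of _ n] replace_row_def)
  hence "of_nat n * cofactor ?B r c = signof p * (of_nat n * cofactor A r c)"
    using det_replace_row_zero_row_sums[OF _ rowsB lt, of ?one]
      det_replace_row_zero_row_sums[OF A rows lt, of ?one] by simp
  hence "\<bar>of_nat n * cofactor ?B r c\<bar> = \<bar>of_nat n * cofactor A r c\<bar>"
    by (cases "evenperm p") (auto simp: sign_def abs_mult)
  thus ?thesis using lt by (simp add: abs_mult)
qed

section \<open>Circulant matrices\<close>

text \<open>
  The matrix \<open>S - x\<close> for the cyclic shift \<open>S\<close>.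
\<close>

definition shift_minus :: "nat \<Rightarrow> 'a :: comm_ring_1 \<Rightarrow> 'a mat" where
  "shift_minus n x = mat n n (\<lambda>(i, j). of_bool (j = (i + 1) mod n) - x * of_bool (j = i))"

lemma shift_minus_carrier [simp]: "shift_minus n x \<in> carrier_mat n n"
  by (simp add: shift_minus_def)

lemma shift_minus_dim [simp]: "dim_row (shift_minus n x) = n" "dim_col (shift_minus n x) = n"
  by (simp_all add: shift_minus_def)

lemma shift_minus_index:
  "i < n \<Longrightarrow> j < n \<Longrightarrow> shift_minus n x $$ (i, j) = of_bool (j = (i + 1) mod n) - x * of_bool (j = i)"
  by (simp add: shift_minus_def)

lemma shift_minus_mult_index:
  assumes B: "B \<in> carrier_mat n n" and ij: "i < n" "j < n"
  shows "(shift_minus n x * B) $$ (i, j) = B $$ ((i + 1) mod n, j) - x * B $$ (i, j)"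
proof -
  have lt: "(i + 1) mod n < n" using ij by simp
  have "(shift_minus n x * B) $$ (i, j)
      = (\<Sum>l<n. (of_bool (l = (i + 1) mod n) - x * of_bool (l = i)) * B $$ (l, j))"
    using B ij by (simp add: shift_minus_def scalar_prod_def lessThan_atLeast0)
  also have "\<dots> = (\<Sum>l<n. (if l = (i + 1) mod n then B $$ (l, j) else 0)
      - (if l = i then x * B $$ (l, j) else 0))"
    by (intro sum.cong) (auto simp: algebra_simps)
  also have "\<dots> = B $$ ((i + 1) mod n, j) - x * B $$ (i, j)"
    using lt ij by (simp add: sum_subtractf)
  finally show ?thesis .
qed

lemma shift_minus_row_sum:
  assumes "i < n" shows "(\<Sum>j<n. shift_minus n x $$ (i, j)) = 1 - x"
proof -
  have "(\<Sum>j<n. shift_minus n x $$ (i, j)) = (\<Sum>j<n. of_bool (j = (i + 1) mod n) - x * of_bool (j = i))"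
    using assms by (simp add: shift_minus_index)
  thus ?thesis using assms by (simp add: sum_subtractf flip: sum_distrib_left) 
qed

lemma sum_shift_mod:
  fixes f :: "nat \<Rightarrow> 'a :: comm_monoid_add"
  shows "(\<Sum>i<n. f ((i + 1) mod n)) = (\<Sum>i<n. f i)"
proof (cases n)
  case (Suc m)
  have "(\<Sum>i<n. f ((i + 1) mod n)) = (\<Sum>i<m. f ((i + 1) mod n)) + f 0"
    unfolding Suc by (simp add: add.commute)
  also have "(\<Sum>i<m. f ((i + 1) mod n)) = (\<Sum>i<m. f (Suc i))"
    using Suc by (intro sum.cong) auto
  also have "\<dots> + f 0 = (\<Sum>i<n. f i)"
    unfolding Suc by (subst sum.lessThan_Suc_shift) (rule add.commute)
  finally show ?thesis .
qed simp

lemma shift_minus_column_sum: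
  assumes j: "j < n" shows "(\<Sum>i<n. shift_minus n x $$ (i, j)) = 1 - x"
proof -
  have "(\<Sum>i<n. shift_minus n x $$ (i, j))
      = (\<Sum>i<n. of_bool (j = (i + 1) mod n)) - x * (\<Sum>i<n. of_bool (j = i))"
    using j by (simp add: shift_minus_index sum_subtractf sum_distrib_left)
  also have "(\<Sum>i<n. of_bool (j = (i + 1) mod n) :: 'a) = (\<Sum>i<n. of_bool (j = i))"
    by (rule sum_shift_mod)
  finally show ?thesis using j by (simp add: of_bool_def)
qed

lemma shift_minus_mult_row_sum:
  assumes B: "B \<in> carrier_mat n n" and rows: "\<And>i. i < n \<Longrightarrow> (\<Sum>j<n. B $$ (i, j)) = s"
    and i: "i < n"
  shows "(\<Sum>j<n. (shift_minus n x * B) $$ (i, j)) = (1 - x) * s"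
proof -
  have lt: "(i + 1) mod n < n" using i by simp
  show ?thesis using i rows[OF i] rows[OF lt]
    by (simp add: shift_minus_mult_index[OF B] sum_subtractf algebra_simps flip: sum_distrib_left)
qed

lemma shift_minus_mult_column_sum:
  assumes B: "B \<in> carrier_mat n n" and cols: "(\<Sum>i<n. B $$ (i, j)) = s"
    and j: "j < n"
  shows "(\<Sum>i<n. (shift_minus n x * B) $$ (i, j)) = (1 - x) * s"
  using j cols sum_shift_mod[of "\<lambda>i. B $$ (i, j)" n]
  by (simp add: shift_minus_mult_index[OF B] sum_subtractf algebra_simps flip: sum_distrib_left)

lemma cofactor_shift_minus_first:
  assumes n: "n \<ge> 2"
  shows "cofactor (shift_minus n x) 0 0 = (-x) ^ (n - 1)"
proof -
  let ?D = "mat_delete (shift_minus n x) 0 0"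
  have D: "?D \<in> carrier_mat (n - 1) (n - 1)" by (rule mat_delete_carrier) simp
  have idx: "?D $$ (i, j) = of_bool (j = i + 1) - x * of_bool (j = i)"
    if "i < n - 1" "j < n - 1" for i j
  proof (cases "i + 2 = n")
    case True thus ?thesis using that n by (auto simp: mat_delete_def shift_minus_def)
  next
    case False
    hence "(i + 2) mod n = i + 2" using that n by (intro mod_less) linarith
    thus ?thesis using that n by (simp add: mat_delete_def shift_minus_def)
  qed
  have "det ?D = prod_list (diag_mat ?D)"
    using D by (intro det_upper_triangular[of _ "n - 1"]) (auto simp: upper_triangular_def idx)
  also have "diag_mat ?D = map (\<lambda>i. - x) [0..<n - 1]"
    using D by (auto simp: diag_mat_def idx)
  finally show ?thesis by (simp add: cofactor_def map_replicate_const)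
qed

lemma cofactor_shift_minus_last:
  assumes n: "n \<ge> 2"
  shows "cofactor (shift_minus n x) (n - 1) 0 = (-1) ^ (n - 1)"
proof -
  let ?D = "mat_delete (shift_minus n x) (n - 1) 0"
  have D: "?D \<in> carrier_mat (n - 1) (n - 1)" by (rule mat_delete_carrier) simp
  have idx: "?D $$ (i, j) = of_bool (j = i) - x * of_bool (Suc j = i)"
    if "i < n - 1" "j < n - 1" for i j
    using that n by (simp add: mat_delete_def shift_minus_def)
  have "det ?D = prod_list (diag_mat ?D)"
    using D by (intro det_lower_triangular[of "n - 1"]) (auto simp: idx[simplified])
  also have "diag_mat ?D = map (\<lambda>i. 1) [0..<n - 1]"
    using D by (auto simp: diag_mat_def idx[simplified])
  finally show ?thesis by (simp add: cofactor_def map_replicate_const)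
qed

text \<open>
  The first column has at most two nonzero entries, at its top and at its bottom, and the two
  complementary minors are triangular.
\<close>

lemma det_shift_minus:
  assumes n: "n \<ge> 2"
  shows "det (shift_minus n x) = (-x) ^ n - (-1) ^ n"
proof -
  have "det (shift_minus n x) = (\<Sum>i<n. shift_minus n x $$ (i, 0) * cofactor (shift_minus n x) i 0)"
    using n by (intro laplace_expansion_column) auto
  also have "\<dots> = (\<Sum>i\<in>{0, n - 1}. shift_minus n x $$ (i, 0) * cofactor (shift_minus n x) i 0)"
  proof (rule sum.mono_neutral_right)
    show "\<forall>i\<in>{..<n} - {0, n - 1}. shift_minus n x $$ (i, 0) * cofactor (shift_minus n x) i 0 = 0"
    proof
      fix i assume "i \<in> {..<n} - {0, n - 1}"
      hence "0 < i" "i + 1 < n" by auto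
      thus "shift_minus n x $$ (i, 0) * cofactor (shift_minus n x) i 0 = 0" by (simp add: shift_minus_index)
    qed
  qed (use n in auto)
  also have "\<dots> = (-x) * (-x) ^ (n - 1) + (-1) ^ (n - 1)"
    using n by (simp add: shift_minus_index cofactor_shift_minus_first cofactor_shift_minus_last[simplified])
  also have "\<dots> = (-x) ^ n - (-1) ^ n"
    using n by (cases n) auto
  finally show ?thesis .
qed

text \<open>
  Row \<open>i\<close> is the equation of crossing \<open>i\<close>, with the arcs numbered by the crossing at which they end.
  For \<open>N = 2\<close> the columns \<open>i\<close> and \<open>(i + 2) mod N\<close> coincide and their entries add up.
\<close>

definition turk_head_matrix :: "nat \<Rightarrow> 'a :: comm_ring_1 mat" where
  "turk_head_matrix N = mat N N (\<lambda>(i, j).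
     2 * of_bool (j = (i + 2) mod N) - of_bool (j = i) - of_bool (j = (i + 3) mod N))"

lemma turk_head_matrix_carrier [simp]: "turk_head_matrix N \<in> carrier_mat N N"
  by (simp add: turk_head_matrix_def)

text \<open>
  This is \<open>2 X\<^sup>2 - 1 - X\<^sup>3 = - (X - 1) (X - a) (X - b)\<close>.  The sign is put on the quadratic factor because
  \<open>(1 - a) (1 - b) = -1\<close>, so that its row and column sums become 1.
\<close>

lemma turk_head_matrix_factor:
  fixes a b :: "'a :: comm_ring_1"
  assumes ab: "a + b = 1" "a * b = -1"
  shows "turk_head_matrix N = shift_minus N 1 * ((-1) \<cdot>\<^sub>m (shift_minus N a * shift_minus N b))"
proof (rule eq_matI)
  fix i j
  assume "i < dim_row (shift_minus N 1 * ((-1) \<cdot>\<^sub>m (shift_minus N a * shift_minus N b)))"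
     and "j < dim_col (shift_minus N 1 * ((-1) \<cdot>\<^sub>m (shift_minus N a * shift_minus N b)))"
  hence ij: "i < N" "j < N" by simp_all
  have C: "shift_minus N a * shift_minus N b \<in> carrier_mat N N" by (meson shift_minus_carrier mult_carrier_mat)
  have Q: "(shift_minus N a * shift_minus N b) $$ (k, j)
      = of_bool (j = (k + 2) mod N) - of_bool (j = (k + 1) mod N) - of_bool (j = k)"
    if k: "k < N" for k
  proof -
    have "(shift_minus N a * shift_minus N b) $$ (k, j) = of_bool (j = (k + 2) mod N)
        - (a + b) * of_bool (j = (k + 1) mod N) + (a * b) * of_bool (j = k)"
      using k ij
      by (simp add: shift_minus_mult_index[of _ N] shift_minus_index mod_Suc_eq algebra_simps
          del: index_mult_mat)
    thus ?thesis using ab by simp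
  qed
  have lt: "(i + 1) mod N < N" using ij by simp
  have shift: "((i + 1) mod N + 2) mod N = (i + 3) mod N"
    "((i + 1) mod N + 1) mod N = (i + 2) mod N"
    using mod_add_left_eq[of "i + 1" N 2] mod_add_left_eq[of "i + 1" N 1]
    by (simp_all add: eval_nat_numeral)
  have "(shift_minus N 1 * ((-1) \<cdot>\<^sub>m (shift_minus N a * shift_minus N b))) $$ (i, j)
      = (shift_minus N a * shift_minus N b) $$ (i, j) - (shift_minus N a * shift_minus N b) $$ ((i + 1) mod N, j)"
    using ij lt C by (subst shift_minus_mult_index[of _ N]) auto
  also have "\<dots> = 2 * of_bool (j = (i + 2) mod N) - of_bool (j = i) - of_bool (j = (i + 3) mod N)"
    unfolding Q[OF ij(1)] Q[OF lt] shift using ij by simp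
  finally show "turk_head_matrix N $$ (i, j)
      = (shift_minus N 1 * ((-1) \<cdot>\<^sub>m (shift_minus N a * shift_minus N b))) $$ (i, j)"
    using ij by (simp add: turk_head_matrix_def)
qed (simp_all add: turk_head_matrix_def)

lemma cofactor_turk_head_matrix:
  fixes a b :: "'a :: field_char_0"
  assumes ab: "a + b = 1" "a * b = -1" and N: "even N" "N > 0" and lt: "r < N" "c < N"
  shows "cofactor (turk_head_matrix N) r c = - ((a ^ N - 1) * (b ^ N - 1))"
proof -
  have N2: "N \<ge> 2" using N by presburger
  define Q where "Q = (-1) \<cdot>\<^sub>m (shift_minus N a * shift_minus N b)"
  have C: "shift_minus N a * shift_minus N b \<in> carrier_mat N N" by (meson shift_minus_carrier mult_carrier_mat)
  have Q: "Q \<in> carrier_mat N N" using C by (simp add: Q_def)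
  have unit: "(1 - a) * (1 - b) = -1" using ab by (simp add: algebra_simps)
  have rowsQ: "(\<Sum>j<N. Q $$ (i, j)) = 1" if "i < N" for i
    using shift_minus_mult_row_sum[of "shift_minus N b" N "1 - b" i a] shift_minus_row_sum[of _ N b] that C unit
    by (simp add: Q_def sum_negf)
  have colsQ: "(\<Sum>i<N. Q $$ (i, j)) = 1" if "j < N" for j
    using shift_minus_mult_column_sum[of "shift_minus N b" N j "1 - b" a] shift_minus_column_sum[of _ N b] that C unit
    by (simp add: Q_def sum_negf)
  have "cofactor (turk_head_matrix N) r c = cofactor (shift_minus N 1) r c * det Q"
    unfolding turk_head_matrix_factor[OF ab] Q_def[symmetric]
    using Q rowsQ colsQ lt by (intro cofactor_mult_unit_sums[of _ N]) (auto simp: shift_minus_row_sum)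
  also have "cofactor (shift_minus N 1) r c = cofactor (shift_minus N 1 :: 'a mat) 0 0"
    using lt by (intro cofactor_eq_zero_row_column_sums[of _ N])
      (auto simp: shift_minus_row_sum shift_minus_column_sum)
  also have "\<dots> = -1" using N N2 by (simp add: cofactor_shift_minus_first)
  also have "det Q = (a ^ N - 1) * (b ^ N - 1)"
    using N N2 C by (simp add: Q_def det_mult[of _ N] det_shift_minus)
  finally show ?thesis by simp
qed

lemma turk_head_matrix_row_sum:
  fixes i :: nat
  assumes "i < N"
  shows "(\<Sum>j<N. turk_head_matrix N $$ (i, j) :: 'a :: comm_ring_1) = 0"
proof -
  have "(\<Sum>j<N. turk_head_matrix N $$ (i, j) :: 'a) = (\<Sum>j<N. 
     2 * of_bool (j = (i + 2) mod N) - of_bool (j = i) - of_bool (j = (i + 3) mod N))"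
    using assms by (simp add: turk_head_matrix_def)
  thus ?thesis using assms by (simp add: sum_subtractf flip: sum_distrib_left)
qed



section \<open>The arcs of the closed braid\<close>

text \<open>
  A labelling identifies the arcs as soon as it is constant along joins and every point can be joined
  to a representative that depends only on its label.
\<close>

lemma arcs_eq_fibres:
  assumes joins: "\<And>p q. (p, q) \<in> joins D \<Longrightarrow> f p = f q"
    and rep: "\<And>p. p \<in> points D \<Longrightarrow> (p, rep (f p)) \<in> (joins D \<union> (joins D)\<inverse>)\<^sup>*"
  shows "arcs D = (\<lambda>k. {q \<in> points D. f q = k}) ` f ` points D"
proof -
  let ?R = "joins D \<union> (joins D)\<inverse>"
  have "f p = f q" if "(p, q) \<in> ?R\<^sup>*" for p q
    using that by (induction rule: rtrancl_induct) (auto dest: joins)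
  moreover have "(p, q) \<in> ?R\<^sup>*" if "p \<in> points D" "q \<in> points D" "f p = f q" for p q
  proof -
    have "sym (?R\<^sup>*)" by (intro sym_rtrancl) (auto simp: sym_def)
    hence "(rep (f q), q) \<in> ?R\<^sup>*" using rep[OF that(2)] by (meson symD)
    thus ?thesis using rep[OF that(1)] that(3) by (metis rtrancl_trans)
  qed
  ultimately have "arc_rel D = {(p, q). p \<in> points D \<and> q \<in> points D \<and> f p = f q}"
    by (auto simp: arc_rel_def)
  hence "arc_rel D `` {p} = {q \<in> points D. f q = f p}" if "p \<in> points D" for p
    using that by auto
  thus ?thesis by (simp add: arcs_def quotient_def image_image UNION_singleton_eq_range)
qed

text \<open>
  Of the two outer positions, letter \<open>t\<close> uses one, where the under-strand enters, and leaves the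
  other one alone.  The two exchange their roles from one letter to the next.
\<close>

definition under_pos :: "nat \<Rightarrow> nat" where
  "under_pos t = (if even t then 3 else 1)"

definition idle_pos :: "nat \<Rightarrow> nat" where
  "idle_pos t = (if even t then 1 else 3)"

lemma pos_Suc [simp]: "under_pos (Suc t) = idle_pos t" "idle_pos (Suc t) = under_pos t"
  by (simp_all add: under_pos_def idle_pos_def)

lemma pos_even [simp]: "even t \<Longrightarrow> under_pos t = 3" "even t \<Longrightarrow> idle_pos t = 1"
  by (simp_all add: under_pos_def idle_pos_def)

lemma pos_neq [simp]: "under_pos t \<noteq> 2" "idle_pos t \<noteq> 2" "idle_pos t \<noteq> under_pos t"
  "under_pos t \<noteq> idle_pos t"
  by (simp_all add: under_pos_def idle_pos_def)

lemma pos_cases: "p \<in> {1..3} \<longleftrightarrow> p = under_pos t \<or> p = idle_pos t \<or> p = 2"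
  by (auto simp: under_pos_def idle_pos_def)

lemma THK3_word_nth:
  "t < 2 * n \<Longrightarrow>
    concat (replicate n [Gen 2, GenInv 1]) ! t = (if even t then Gen 2 else GenInv 1)"
proof (induction n arbitrary: t)
  case (Suc n)
  show ?case
  proof (cases "t < 2")
    case True thus ?thesis by (auto simp: less_2_cases_iff)
  next
    case False
    then obtain s where s: "t = Suc (Suc s)" by (metis add_2_eq_Suc le_Suc_ex not_less)
    thus ?thesis using Suc by simp
  qed
qed simp

lemma THK3_word_length: "length (concat (replicate n [Gen 2, GenInv 1])) = 2 * n"
  by (simp add: length_concat sum_list_replicate)

lemma THK3_word_in:
  assumes "t < 2 * n"
  defines "g \<equiv> concat (replicate n [Gen 2, GenInv 1]) ! t"
  shows "over_in g = 2" "under_in g = under_pos t"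
    "p \<in> {1..3} \<and> p \<noteq> gen_index g \<and> p \<noteq> gen_index g + 1 \<longleftrightarrow> p = idle_pos t"
  unfolding g_def THK3_word_nth[OF assms(1)] by (auto simp: under_pos_def idle_pos_def)

lemma THK3_points: "points (THK3 n) = {0..2 * n} \<times> {1..3}"
  unfolding THK3_def closed_braid_def THK3_word_length by simp

lemma THK3_joins:
  "joins (THK3 n) = {((t, idle_pos t), (Suc t, idle_pos t)) | t. t < 2 * n}
     \<union> {((t, 2), (Suc t, under_pos t)) | t. t < 2 * n}
     \<union> {((2 * n, p), (0, p)) | p. p \<in> {1..3}}"
proof -
  let ?w = "concat (replicate n [Gen 2, GenInv 1])"
  have "{((t, p), (Suc t, p)) | t p.
      t < 2 * n \<and> p \<in> {1..3} \<and> p \<noteq> gen_index (?w ! t) \<and> p \<noteq> gen_index (?w ! t) + 1}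
    = {((t, idle_pos t), (Suc t, idle_pos t)) | t. t < 2 * n}"
    using THK3_word_in(3) by blast
  moreover have "{((t, over_in (?w ! t)), (Suc t, under_in (?w ! t))) | t. t < 2 * n}
    = {((t, 2), (Suc t, under_pos t)) | t. t < 2 * n}"
    using THK3_word_in(1,2) by force
  ultimately show ?thesis
    unfolding THK3_def closed_braid_def THK3_word_length by simp
qed

lemma THK3_crossings:
  "crossings (THK3 n) = map (\<lambda>t. ((t, 2), (t, under_pos t), (Suc t, 2))) [0..<2 * n]"
  unfolding THK3_def closed_braid_def THK3_word_length
  by (simp add: THK3_word_in(1,2)[simplified])

text \<open>
  The letter, modulo the length of the word, at which the arc through a point ends: the strand in
  the middle position goes under two letters later, the one in the idle position one letter later.
\<close>

definition arc_ix :: "nat \<Rightarrow> nat \<times> nat \<Rightarrow> nat" where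
  "arc_ix n = (\<lambda>(t, p). (t + (if p = 2 then 2 else if p = under_pos t then 0 else 1)) mod (2 * n))"

lemma arc_ix_joins:
  assumes "(p, q) \<in> joins (THK3 n)"
  shows "arc_ix n p = arc_ix n q"
  using assms by (auto simp: THK3_joins arc_ix_def) 

text \<open>
  Following the arc forward, a point in the middle moves to the idle position, from there to the
  position where the under-strand enters, and ends there.  At time \<open>2 * n\<close> it
  first jumps back to time 0.
\<close>

lemma THK3_joined_to_under_end:
  assumes n: "n > 0" and q: "q \<in> points (THK3 n)"
  shows "(q, (arc_ix n q, under_pos (arc_ix n q)))
    \<in> (joins (THK3 n) \<union> (joins (THK3 n))\<inverse>)\<^sup>*"
proof -
  let ?J = "joins (THK3 n) \<union> (joins (THK3 n))\<inverse>"
  let ?end = "\<lambda>q. (arc_ix n q, under_pos (arc_ix n q))"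
  have step: "(q, ?end q) \<in> ?J\<^sup>*" if "(q, q') \<in> joins (THK3 n)" "(q', ?end q') \<in> ?J\<^sup>*" for q q'
    using that arc_ix_joins[OF that(1)] by (metis UnI1 converse_rtrancl_into_rtrancl)
  have wrap: "((2 * n, p), (0, p)) \<in> joins (THK3 n)" if "p \<in> {1..3}" for p
    using that by (auto simp: THK3_joins)
  have stay: "((t, idle_pos t), (Suc t, idle_pos t)) \<in> joins (THK3 n)"
    and over: "((t, 2), (Suc t, under_pos t)) \<in> joins (THK3 n)" if "t < 2 * n" for t
    using that by (auto simp: THK3_joins)
  have under: "((t, under_pos t), ?end (t, under_pos t)) \<in> ?J\<^sup>*" if t: "t \<le> 2 * n" for t
  proof (cases "t < 2 * n")
    case True thus ?thesis by (simp add: arc_ix_def)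
  next
    case False
    hence "t = 2 * n" using t by simp
    moreover have "((0, 3), ?end (0, 3)) \<in> ?J\<^sup>*" by (simp add: arc_ix_def)
    ultimately show ?thesis using step[OF wrap[of 3]] by simp
  qed
  have third: "((t, idle_pos t), ?end (t, idle_pos t)) \<in> ?J\<^sup>*" if t: "t \<le> 2 * n" for t
  proof -
    have lt: "((t, idle_pos t), ?end (t, idle_pos t)) \<in> ?J\<^sup>*" if "t < 2 * n" for t
      using step[OF stay[OF that]] under[of "Suc t"] that by simp
    show ?thesis
    proof (cases "t < 2 * n")
      case False
      hence "t = 2 * n" using t by simp
      thus ?thesis using n lt[of 0] step[OF wrap[of 1]] by simp
    qed (rule lt)
  qed
  have two: "((t, 2), ?end (t, 2)) \<in> ?J\<^sup>*" if t: "t \<le> 2 * n" for t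
  proof -
    have lt: "((t, 2), ?end (t, 2)) \<in> ?J\<^sup>*" if "t < 2 * n" for t
      using step[OF over[OF that]] third[of "Suc t"] that by simp
    show ?thesis
    proof (cases "t < 2 * n")
      case False
      hence "t = 2 * n" using t by simp
      thus ?thesis using n lt[of 0] step[OF wrap[of 2]] by simp
    qed (rule lt)
  qed
  obtain t p where "q = (t, p)" "t \<le> 2 * n" "p \<in> {1..3}" using q by (auto simp: THK3_points)
  thus ?thesis using under third two pos_cases[of p t] by blast
qed

definition THK3_arc :: "nat \<Rightarrow> nat \<Rightarrow> (nat \<times> nat) set" where
  "THK3_arc n k = {q \<in> points (THK3 n). arc_ix n q = k}"

lemma under_end_in_THK3_arc: "k < 2 * n \<Longrightarrow> (k, under_pos k) \<in> THK3_arc n k"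
  by (auto simp: THK3_arc_def THK3_points arc_ix_def under_pos_def)

lemma arcs_THK3:
  assumes n: "n > 0"
  shows "arcs (THK3 n) = THK3_arc n ` {..<2 * n}"
proof -
  have "arc_ix n ` points (THK3 n) = {..<2 * n}"
  proof
    show "arc_ix n ` points (THK3 n) \<subseteq> {..<2 * n}" using n by (auto simp: arc_ix_def)
    show "{..<2 * n} \<subseteq> arc_ix n ` points (THK3 n)"
      using under_end_in_THK3_arc[of _ n] by (force simp: THK3_arc_def)
  qed
  thus ?thesis
    using arcs_eq_fibres[OF arc_ix_joins THK3_joined_to_under_end[OF n]]
    by (simp add: THK3_arc_def[abs_def])
qed

lemma inj_on_THK3_arc: "inj_on (THK3_arc n) {..<2 * n}"
proof (rule inj_onI)
  fix k l assume "k \<in> {..<2 * n}" and eq: "THK3_arc n k = THK3_arc n l"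
  from this(1) have k: "(k, under_pos k) \<in> THK3_arc n k" using under_end_in_THK3_arc by simp
  hence "(k, under_pos k) \<in> THK3_arc n l" unfolding eq .
  with k show "k = l" by (auto simp: THK3_arc_def)
qed

lemma coloring_coeff_THK3:
  assumes t: "t < 2 * n"
  shows "coloring_coeff (THK3 n) (crossings (THK3 n) ! t) (THK3_arc n s)
    = 2 * of_bool (s = (t + 2) mod (2 * n)) - of_bool (s = t) - of_bool (s = (t + 3) mod (2 * n))"
proof -
  have "(t, 2) \<in> THK3_arc n s \<longleftrightarrow> s = (t + 2) mod (2 * n)"
    "(t, under_pos t) \<in> THK3_arc n s \<longleftrightarrow> s = t"
    "(Suc t, 2) \<in> THK3_arc n s \<longleftrightarrow> s = (t + 3) mod (2 * n)"
    using t by (auto simp: THK3_arc_def THK3_points arc_ix_def under_pos_def eval_nat_numeral)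
  thus ?thesis using t by (simp add: THK3_crossings coloring_coeff_def)
qed

section \<open>The determinant\<close>

text \<open>
  The second and the fourth power in \<open>u (n - 1)\<close> are powers of \<open>- b\<close> and \<open>- a\<close>, so the parity of \<open>n\<close> decides whether
  the terms combine through \<open>a\<^sup>2 + 1 = sqrt 5 * a\<close> and \<open>b\<^sup>2 + 1 = - sqrt 5 * b\<close> or through
  \<open>a\<^sup>2 - 1 = a\<close> and \<open>b\<^sup>2 - 1 = b\<close>.  The value is thus the \<open>n\<close>-th Lucas number for
  odd \<open>n\<close> and the \<open>n\<close>-th Fibonacci number for even \<open>n\<close>.
\<close>

lemma u_golden:
  defines "a \<equiv> (1 + sqrt 5) / 2" and "b \<equiv> (1 - sqrt 5) / 2"
  assumes n: "n > 0"
  shows "u (n - 1) = (if odd n then a ^ n + b ^ n else (a ^ n - b ^ n) / sqrt 5)"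
proof -
  obtain m where m: "n = Suc m" using n by (cases n) auto
  have sq: "a\<^sup>2 = a + 1" "b\<^sup>2 = b + 1" by (auto simp: a_def b_def power2_eq_square field_simps)
  have s5: "a + 2 = sqrt 5 * a" "b + 2 = - sqrt 5 * b" by (auto simp: a_def b_def field_simps)
  have "u m = (a ^ (m + 2) - (- b) ^ m - b ^ (m + 2) + (- a) ^ m) / sqrt 5"
  proof -
    have neg: "(-1 + sqrt 5) / 2 = - b" "(-1 - sqrt 5) / 2 = - a"
      by (auto simp: a_def b_def field_simps)
    show ?thesis unfolding u_def neg a_def[symmetric] b_def[symmetric] by simp
  qed
  also have "\<dots> = (if even m then a ^ m * (a + 2) - b ^ m * (b + 2) else a ^ m * a - b ^ m * b) / sqrt 5"
  proof -
    have "a ^ (m + 2) = a ^ m * (a + 1)" "b ^ (m + 2) = b ^ m * (b + 1)"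
      by (simp_all only: power_add sq)
    thus ?thesis by (simp add: algebra_simps)
  qed
  also have "\<dots> = (if even m then sqrt 5 * (a ^ n + b ^ n) else a ^ n - b ^ n) / sqrt 5"
    unfolding s5 m by (simp add: algebra_simps)
  finally show ?thesis by (simp add: m)
qed


text \<open>
  A numbering of the arcs differs by a permutation from the numbering by end points,
  for which the coloring matrix is \<open>turk_head_matrix\<close>.
\<close>

lemma first_minor_THK3:
  fixes a b :: real
  assumes ab: "a + b = 1" "a * b = -1" and n: "n > 0"
    and m: "m \<in> first_minors (THK3 n)"
  shows "real_of_int m = \<bar>(a ^ (2 * n) - 1) * (b ^ (2 * n) - 1)\<bar>"
proof -
  define N where "N = 2 * n"
  have N: "even N" "N > 0" using n by (simp_all add: N_def)
  have len: "length (crossings (THK3 n)) = N" by (simp add: THK3_crossings N_def)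
  obtain xs r c where xs: "distinct xs" "set xs = arcs (THK3 n)"
    and rc: "r < N" "c < length xs"
    and m_eq: "m = \<bar>det (mat_delete (coloring_matrix (THK3 n) xs) r c)\<bar>"
    using m unfolding first_minors_def len by blast
  define C where "C = coloring_matrix (THK3 n) xs"
  have "mset xs = mset (map (THK3_arc n) [0..<N])"
    using xs inj_on_THK3_arc[of n] arcs_THK3[OF n]
    by (subst set_eq_iff_mset_eq_distinct[symmetric])
      (auto simp: distinct_map N_def lessThan_atLeast0)
  then obtain p where "p permutes {..<length (map (THK3_arc n) [0..<N])}"
    and p_xs: "permute_list p (map (THK3_arc n) [0..<N]) = xs"
    by (rule mset_eq_permutation)
  hence p: "p permutes {0..<N}" by (simp add: lessThan_atLeast0)
  have lenx: "length xs = N" using p_xs by (metis length_map length_permute_list length_upt minus_nat.diff_0)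
  have nth: "xs ! j = THK3_arc n (p j)" if "j < N" for j
    using that permutes_in_image[OF p, of j] unfolding p_xs[symmetric]
    by (simp add: permute_list_def)
  have C: "C \<in> carrier_mat N N" by (simp add: C_def coloring_matrix_def len lenx)
  have "map_mat real_of_int C = mat N N (\<lambda>(i, j). turk_head_matrix N $$ (i, p j))"
    using permutes_in_image[OF p] coloring_coeff_THK3[of _ n]
    by (intro eq_matI)
      (auto simp: C_def coloring_matrix_def len lenx nth turk_head_matrix_def N_def)
  moreover have "\<bar>cofactor (mat N N (\<lambda>(i, j). turk_head_matrix N $$ (i, p j))) r c\<bar>
      = \<bar>cofactor (turk_head_matrix N :: real mat) r c\<bar>"
    using p rc lenx
    by (intro abs_cofactor_permute_columns) (auto simp: turk_head_matrix_row_sum)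
  moreover have "cofactor (turk_head_matrix N) r c = - ((a ^ N - 1) * (b ^ N - 1))"
    using rc lenx by (intro cofactor_turk_head_matrix ab N) auto
  ultimately have cof: "\<bar>cofactor (map_mat real_of_int C) r c\<bar> = \<bar>(a ^ N - 1) * (b ^ N - 1)\<bar>"
    by simp
  have "mat_delete (map_mat real_of_int C) r c = map_mat real_of_int (mat_delete C r c)"
    using C rc lenx by (intro eq_matI) (auto simp: mat_delete_def)
  hence "\<bar>cofactor (map_mat real_of_int C) r c\<bar> = real_of_int m"
    by (simp add: cofactor_def m_eq C_def abs_mult power_abs)
  with cof show ?thesis by (simp add: N_def)
qed

text \<open>
  Together with \<open>first_minor_THK3\<close> this makes the set of first minors a singleton, so that \<open>link_det\<close>
  is its element.
\<close>

lemma first_minors_THK3_nonempty: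
  assumes n: "n > 0"
  shows "first_minors (THK3 n) \<noteq> {}"
proof -
  let ?xs = "map (THK3_arc n) [0..<2 * n]"
  have "distinct ?xs" "set ?xs = arcs (THK3 n)" "0 < length (crossings (THK3 n))" "0 < length ?xs"
    using n inj_on_THK3_arc[of n] arcs_THK3[OF n]
    by (auto simp: distinct_map lessThan_atLeast0 THK3_crossings)
  thus ?thesis unfolding first_minors_def by blast
qed

theorem corollary1p1:
  fixes n :: nat
  assumes "n > 0"
  shows "real_of_int (link_det (THK3 n)) =
           (if odd n then (u (n - 1))\<^sup>2 else 5 * (u (n - 1))\<^sup>2)
         \<and> link_det (THK3 n) \<noteq> 0"
proof -
  define a b :: real where "a = (1 + sqrt 5) / 2" and "b = (1 - sqrt 5) / 2"
  have ab: "a + b = 1" "a * b = -1" by (auto simp: a_def b_def field_simps)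
  define v where "v = \<bar>(a ^ (2 * n) - 1) * (b ^ (2 * n) - 1)\<bar>"
  have minors: "real_of_int m = v" if "m \<in> first_minors (THK3 n)" for m
    using first_minor_THK3[OF ab assms that] by (simp add: v_def)
  obtain d where d: "d \<in> first_minors (THK3 n)"
    using first_minors_THK3_nonempty[OF assms] by blast
  have "m = d" if "m \<in> first_minors (THK3 n)" for m
    using minors[OF that] minors[OF d] by linarith
  hence "first_minors (THK3 n) = {d}" using d by blast
  hence det: "real_of_int (link_det (THK3 n)) = v" using minors[OF d] by (simp add: link_det_def)
  have prod1: "a ^ n * b ^ n = (-1) ^ n" by (simp add: ab flip: power_mult_distrib)
  have prod2: "a ^ (2 * n) * b ^ (2 * n) = 1" by (simp add: ab flip: power_mult_distrib)
  have expand: "(a ^ (2 * n) - 1) * (b ^ (2 * n) - 1) = - (a ^ (2 * n) + b ^ (2 * n) - 2)"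
    using prod2 by (simp add: algebra_simps)
  define w where "w = (if odd n then (u (n - 1))\<^sup>2 else 5 * (u (n - 1))\<^sup>2)"
  have "w = a ^ (2 * n) + b ^ (2 * n) - 2"
  proof (cases "odd n")
    case True
    hence "w = (a ^ n + b ^ n)\<^sup>2"
      using u_golden[OF assms] by (simp add: w_def a_def b_def)
    also have "\<dots> = (a ^ n)\<^sup>2 + (b ^ n)\<^sup>2 + 2 * (a ^ n * b ^ n)"
      by (simp add: power2_eq_square algebra_simps)
    finally show ?thesis using True by (simp add: prod1 mult.commute flip: power_mult)
  next
    case False
    hence "w = (a ^ n - b ^ n)\<^sup>2"
      using u_golden[OF assms] by (simp add: w_def a_def b_def power_divide)
    also have "\<dots> = (a ^ n)\<^sup>2 + (b ^ n)\<^sup>2 - 2 * (a ^ n * b ^ n)"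
      by (simp add: power2_eq_square algebra_simps)
    finally show ?thesis using False by (simp add: prod1 mult.commute flip: power_mult)
  qed
  moreover have "w \<ge> 0" by (simp add: w_def)
  ultimately have "v = w" unfolding v_def expand by simp
  have "a > 1" by (simp add: a_def)
  hence "a ^ (2 * n) > 1" using assms by (intro one_less_power) auto
  moreover from this have "b ^ (2 * n) \<noteq> 1" using prod2 by auto
  ultimately have "v \<noteq> 0" by (simp add: v_def)
  with det \<open>v = w\<close> show ?thesis by (auto simp: w_def)
qed

end
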